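(* Let $X$ be a non-negative, absolutely continuous random variable with $\mathbb{E}X<+\infty$. Then: (i) If $X$ is IGFR, then $X$ is DGMRD. (ii) If $X$ is DGMRD and its mean residual demand function $\mathrm{m}(x)$ is $\log$-convex (i.e. $\ln \mathrm{m}$ is convex on $(0,H)$), then $X$ is IGFR.
   Context: Let $F$ be the distribution function of $X$, $\bar F:=1-F$, $f$ its density ($F'=f$ almost everywhere), and $H:=\inf\{x\ge 0: F(x)=1\}\le+\infty$. The mean residual demand (MRD) function is $\mathrm{m}(x):=\mathbb{E}(X-x\mid X>x)=\frac{1}{\bar F(x)}\int_x^{+\infty}\bar F(u)\,du$ for $x<H$ and $\mathrm{m}(x):=0$ otherwise. The generalized mean residual demand (GMRD) function is $\ell(x):=\mathrm{m}(x)/x$ for $0<x<H$. $X$ is DGMRD (decreasing generalized mean residual demand) if $\ell$ is non-increasing on $(0,H)$. The hazard rate is $\mathrm{h}(x):=f(x)/\bar F(x)$ and the generalized failure rate (GFR) is $\mathrm{g}(x):=x\,\mathrm{h}(x)$ for $x<H$. $X$ is IGFR (increasing generalized failure rate) if $\mathrm{g}(x)$ is non-decreasing for $0<x<H$; since a density is determined only up to null sets, this means that it holds for some version of the density $f$. *)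

theory Defs
  imports "HOL-Probability.Probability"
begin

definition dist_fun :: "'a measure \<Rightarrow> ('a \<Rightarrow> real) \<Rightarrow> real \<Rightarrow> real" where
  "dist_fun M X = cdf (distr M borel X)"

definition tail_fun :: "'a measure \<Rightarrow> ('a \<Rightarrow> real) \<Rightarrow> real \<Rightarrow> real" where
  "tail_fun M X x = 1 - dist_fun M X x"

text \<open>The infimum is taken in the extended reals, where the infimum of the empty set is infinity.\<close>

definition right_end :: "'a measure \<Rightarrow> ('a \<Rightarrow> real) \<Rightarrow> ereal" where
  "right_end M X = Inf {ereal x |x. 0 \<le> x \<and> dist_fun M X x = 1}"

definition demand_interval :: "'a measure \<Rightarrow> ('a \<Rightarrow> real) \<Rightarrow> real set" where
  "demand_interval M X = {x. 0 < x \<and> ereal x < right_end M X}"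

text \<open>The conditional expectation given the event that X exceeds x is the expectation under
  the conditional measure. The expression by the integrated tail is lemma \<open>mrd_eq_tail_integral\<close>.\<close>

definition mrd :: "'a measure \<Rightarrow> ('a \<Rightarrow> real) \<Rightarrow> real \<Rightarrow> real" where
  "mrd M X x =
     (if ereal x < right_end M X
      then \<integral>\<omega>. (X \<omega> - x) \<partial>uniform_measure M {\<omega> \<in> space M. x < X \<omega>}
      else 0)"

definition gmrd :: "'a measure \<Rightarrow> ('a \<Rightarrow> real) \<Rightarrow> real \<Rightarrow> real" where
  "gmrd M X x = mrd M X x / x"

definition DGMRD :: "'a measure \<Rightarrow> ('a \<Rightarrow> real) \<Rightarrow> bool" where
  "DGMRD M X \<longleftrightarrow> antimono_on (demand_interval M X) (gmrd M X)"

text \<open>A density is fixed here as a pointwise real-valued version, since monotonicity of the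
  generalized failure rate depends on the version.\<close>

definition is_density :: "'a measure \<Rightarrow> ('a \<Rightarrow> real) \<Rightarrow> (real \<Rightarrow> real) \<Rightarrow> bool" where
  "is_density M X f \<longleftrightarrow> (\<forall>x. 0 \<le> f x) \<and> distributed M lborel X (\<lambda>x. ennreal (f x))"

definition hazard_rate :: "'a measure \<Rightarrow> ('a \<Rightarrow> real) \<Rightarrow> (real \<Rightarrow> real) \<Rightarrow> real \<Rightarrow> real" where
  "hazard_rate M X f x = f x / tail_fun M X x"

definition gfr :: "'a measure \<Rightarrow> ('a \<Rightarrow> real) \<Rightarrow> (real \<Rightarrow> real) \<Rightarrow> real \<Rightarrow> real" where
  "gfr M X f x = x * hazard_rate M X f x"

definition IGFR :: "'a measure \<Rightarrow> ('a \<Rightarrow> real) \<Rightarrow> bool" where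
  "IGFR M X \<longleftrightarrow> (\<exists>f. is_density M X f \<and> mono_on (demand_interval M X) (gfr M X f))"

definition mrd_log_convex :: "'a measure \<Rightarrow> ('a \<Rightarrow> real) \<Rightarrow> bool" where
  "mrd_log_convex M X \<longleftrightarrow> convex_on (demand_interval M X) (\<lambda>x. ln (mrd M X x))"

lemma tail_fun_eq_prob:
  assumes "prob_space M" and [measurable]: "X \<in> borel_measurable M"
  shows "tail_fun M X x = measure M {\<omega> \<in> space M. x < X \<omega>}"
proof -
  interpret prob_space M by fact
  have "dist_fun M X x = measure M {\<omega> \<in> space M. X \<omega> \<le> x}"
    unfolding dist_fun_def cdf_def
    by (subst measure_distr) (auto intro!: arg_cong[where f = "measure M"])
  moreover have "measure M {\<omega> \<in> space M. \<not> X \<omega> \<le> x} = 1 - measure M {\<omega> \<in> space M. X \<omega> \<le> x}"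
    by (rule prob_neg) measurable
  ultimately show ?thesis
    by (simp add: tail_fun_def not_le)
qed

lemma tail_fun_pos:
  assumes "prob_space M" and [measurable]: "X \<in> borel_measurable M"
    and "AE \<omega> in M. 0 \<le> X \<omega>" and "ereal x < right_end M X"
  shows "0 < tail_fun M X x"
proof -
  interpret prob_space M by fact
  have less_1: "0 < tail_fun M X y" if "0 \<le> y" "ereal y < right_end M X" for y
  proof -
    have "dist_fun M X y \<noteq> 1"
    proof
      assume "dist_fun M X y = 1"
      then have "right_end M X \<le> ereal y"
        unfolding right_end_def using that by (intro Inf_lower) auto
      with that show False by simp
    qed
    moreover have "0 \<le> tail_fun M X y"
      by (simp add: tail_fun_eq_prob[OF assms(1,2)])
    ultimately show ?thesis
      by (auto simp: tail_fun_def)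
  qed
  show ?thesis
  proof (cases "0 \<le> x")
    case True
    with less_1 assms show ?thesis by blast
  next
    case False
    with assms(3) have "AE \<omega> in M. x < X \<omega>"
      by (auto elim: eventually_mono)
    then have "measure M {\<omega> \<in> space M. x < X \<omega>} = 1"
      by (subst prob_Collect_eq_1) auto
    then show ?thesis
      by (simp add: tail_fun_eq_prob[OF assms(1,2)])
  qed
qed

lemma mrd_eq_tail_integral:
  assumes "prob_space M" and [measurable]: "X \<in> borel_measurable M"
    and "AE \<omega> in M. 0 \<le> X \<omega>" and "ereal x < right_end M X"
  shows "mrd M X x = (LBINT u:{x<..}. tail_fun M X u) / tail_fun M X x"
proof -
  interpret prob_space M by fact
  interpret P: pair_sigma_finite M lborel ..
  let ?A = "{\<omega> \<in> space M. x < X \<omega>}"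
  have pos: "0 < measure M ?A"
    using tail_fun_pos[OF assms] by (simp add: tail_fun_eq_prob[OF assms(1,2)])
  have um: "uniform_measure M ?A = density M (\<lambda>\<omega>. ennreal (indicator ?A \<omega> / measure M ?A))"
    unfolding uniform_measure_def using pos
    by (intro arg_cong[where f = "density M"] ext)
       (simp add: emeasure_eq_measure ennreal_indicator divide_ennreal[symmetric])
  have "(\<integral>\<omega>. (X \<omega> - x) \<partial>uniform_measure M ?A)
      = (\<integral>\<omega>. (indicator ?A \<omega> * (X \<omega> - x)) / measure M ?A \<partial>M)"
    unfolding um by (subst integral_density) auto
  also have "\<dots> = (\<integral>\<omega>. indicator ?A \<omega> * (X \<omega> - x) \<partial>M) / measure M ?A"
    by simp
  finally have 1: "mrd M X x = (\<integral>\<omega>. indicator ?A \<omega> * (X \<omega> - x) \<partial>M) / measure M ?A"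
    using assms(4) by (simp add: mrd_def)
  have Fm [measurable]: "tail_fun M X \<in> borel_measurable borel"
  proof -
    have "mono (\<lambda>u. - tail_fun M X u)"
      by (intro monoI) (auto simp: tail_fun_eq_prob[OF assms(1,2)] intro!: finite_measure_mono)
    then have "(\<lambda>u. - tail_fun M X u) \<in> borel_measurable borel"
      by (rule borel_measurable_mono)
    then show ?thesis by simp
  qed
  have "(\<integral>\<^sup>+u. ennreal (indicator {x<..} u * tail_fun M X u) \<partial>lborel)
      = (\<integral>\<^sup>+u. (\<integral>\<^sup>+\<omega>. indicator {p \<in> space (M \<Otimes>\<^sub>M lborel). x < snd p \<and> snd p < X (fst p)} (\<omega>, u) \<partial>M) \<partial>lborel)"
  proof (intro nn_integral_cong)
    fix u :: real
    have "(\<integral>\<^sup>+\<omega>. indicator {p \<in> space (M \<Otimes>\<^sub>M lborel). x < snd p \<and> snd p < X (fst p)} (\<omega>, u) \<partial>M)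
       = (\<integral>\<^sup>+\<omega>. indicator {x<..} u * indicator {\<omega> \<in> space M. u < X \<omega>} \<omega> \<partial>M)"
      by (intro nn_integral_cong) (auto simp: space_pair_measure split: split_indicator)
    also have "\<dots> = indicator {x<..} u * emeasure M {\<omega> \<in> space M. u < X \<omega>}"
      by (subst nn_integral_cmult_indicator) auto
    also have "\<dots> = ennreal (indicator {x<..} u * tail_fun M X u)"
      by (simp add: tail_fun_eq_prob[OF assms(1,2)] emeasure_eq_measure split: split_indicator)
    finally show "ennreal (indicator {x<..} u * tail_fun M X u)
      = (\<integral>\<^sup>+\<omega>. indicator {p \<in> space (M \<Otimes>\<^sub>M lborel). x < snd p \<and> snd p < X (fst p)} (\<omega>, u) \<partial>M)" ..
  qed
  also have "\<dots> = (\<integral>\<^sup>+\<omega>. (\<integral>\<^sup>+u. indicator {p \<in> space (M \<Otimes>\<^sub>M lborel). x < snd p \<and> snd p < X (fst p)} (\<omega>, u) \<partial>lborel) \<partial>M)"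
    by (rule P.Fubini') measurable
  also have "\<dots> = (\<integral>\<^sup>+\<omega>. ennreal (indicator ?A \<omega> * (X \<omega> - x)) \<partial>M)"
  proof (intro nn_integral_cong)
    fix \<omega> assume \<omega>: "\<omega> \<in> space M"
    have "(\<integral>\<^sup>+u. indicator {p \<in> space (M \<Otimes>\<^sub>M lborel). x < snd p \<and> snd p < X (fst p)} (\<omega>, u) \<partial>lborel)
       = (\<integral>\<^sup>+u. indicator {x<..<X \<omega>} u \<partial>lborel)"
      using \<omega> by (intro nn_integral_cong) (auto simp: space_pair_measure split: split_indicator)
    also have "\<dots> = ennreal (indicator ?A \<omega> * (X \<omega> - x))"
      using \<omega> by (cases "x < X \<omega>") auto
    finally show "(\<integral>\<^sup>+u. indicator {p \<in> space (M \<Otimes>\<^sub>M lborel). x < snd p \<and> snd p < X (fst p)} (\<omega>, u) \<partial>lborel)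
       = ennreal (indicator ?A \<omega> * (X \<omega> - x))" .
  qed
  finally have 2: "(\<integral>\<^sup>+u. ennreal (indicator {x<..} u * tail_fun M X u) \<partial>lborel)
      = (\<integral>\<^sup>+\<omega>. ennreal (indicator ?A \<omega> * (X \<omega> - x)) \<partial>M)" .
  have "(\<integral>\<omega>. indicator ?A \<omega> * (X \<omega> - x) \<partial>M) = (\<integral>u. indicator {x<..} u * tail_fun M X u \<partial>lborel)"
    by (subst (1 2) integral_eq_nn_integral)
       (auto simp: 2[unfolded tail_fun_eq_prob[OF assms(1,2)]] tail_fun_eq_prob[OF assms(1,2)] split: split_indicator)
  with 1 show ?thesis
    by (simp add: set_lebesgue_integral_def tail_fun_eq_prob[OF assms(1,2)])
qed

end

theory Submission
  imports Defs
begin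

text \<open>
  Write \<open>G\<close> for the tail function, \<open>U\<close> for the demand interval and
  \<open>J x\<close> for the integral of \<open>G\<close> over \<open>(x, \<infinity>)\<close>, so that the mean residual demand is \<open>J / G\<close> on \<open>U\<close>.
  Where the derivatives exist, \<open>J' = - G\<close> and \<open>G' = - f\<close>. The tail \<open>G\<close> is continuous and, in both
  directions, the version of the density considered is continuous off a countable set, because it is
  built from a monotone function. Hence \<open>G' = - f\<close> holds off a countable set, and a continuous
  function whose derivative is nonpositive off a countable set is nonincreasing
  (\<open>nonincreasing_if_deriv_nonpos_off_countable\<close>).

  If \<open>X\<close> is IGFR with generalized failure rate \<open>g\<close>, then for each \<open>t \<ge> 1\<close> the logarithmic derivative of
  \<open>x \<mapsto> G (t x) / G x\<close> is \<open>(g x - g (t x)) / x \<le> 0\<close>, so that this ratio is nonincreasing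
  (\<open>tail_ratio_antimono\<close>). Integrating over \<open>t > 1\<close> gives \<open>J x / (x G x)\<close>, the generalized mean residual
  demand, which is therefore nonincreasing.

  Conversely, let \<open>X\<close> be DGMRD with \<open>\<phi> = ln m\<close> convex, where \<open>m = J / G\<close>, and let \<open>p\<close> be a monotone choice of
  subgradients of \<open>\<phi>\<close>. From \<open>G = J exp (- \<phi>)\<close> the hazard rate has to be \<open>h = 1 / m + p\<close>; it is nonnegative
  because \<open>G\<close> is nonincreasing, and \<open>h G\<close> is indeed a version of the density (\<open>is_density_if_tail_deriv\<close>).
  The generalized failure rate is \<open>x h x = x / m x + x p x\<close>. For \<open>x \<le> y\<close> with \<open>p y \<ge> 0\<close> neither
  summand decreases from \<open>x\<close> to \<open>y\<close>, the first by DGMRD. If \<open>p y < 0\<close>, then \<open>m y \<le> m x\<close>, so that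
  \<open>0 \<le> h x \<le> h y\<close>.
\<close>

section \<open>Derivatives off a countable set\<close>

text \<open>If the function increased overall, tilting it slightly would make the derivative negative off
  \<open>S\<close> while it still increased overall. Each intermediate value \<open>y\<close> then has a last point \<open>s y\<close> where
  it is attained; the derivative cannot be negative there, so \<open>s\<close> maps an uncountable interval
  injectively into \<open>S\<close>.\<close>

lemma nonincreasing_if_deriv_nonpos_off_countable:
  fixes \<phi> :: "real \<Rightarrow> real"
  assumes "a \<le> b" and cont: "continuous_on {a..b} \<phi>" and "countable S"
    and deriv: "\<And>x. x \<in> {a<..<b} - S \<Longrightarrow> \<exists>D\<le>0. (\<phi> has_real_derivative D) (at x)"
  shows "\<phi> b \<le> \<phi> a"
proof (rule ccontr)
  assume "\<not> \<phi> b \<le> \<phi> a"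
  then have less: "\<phi> a < \<phi> b" and "a < b"
    using \<open>a \<le> b\<close> by (auto simp: less_le)
  define \<epsilon> where "\<epsilon> = (\<phi> b - \<phi> a) / (2 * (b - a))"
  have "\<epsilon> > 0" using less \<open>a < b\<close> by (simp add: \<epsilon>_def)
  define \<psi> where "\<psi> x = \<phi> x - \<epsilon> * (x - a)" for x
  have contp: "continuous_on {a..b} \<psi>"
    unfolding \<psi>_def by (intro continuous_intros cont)
  have "\<epsilon> * (b - a) = (\<phi> b - \<phi> a) / 2"
    using \<open>a < b\<close> by (simp add: \<epsilon>_def field_simps)
  then have lessp: "\<psi> a < \<psi> b"
    using less by (simp add: \<psi>_def)
  have dp: "\<exists>D<0. (\<psi> has_real_derivative D) (at x)" if "x \<in> {a<..<b} - S" for x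
  proof -
    obtain D where "D \<le> 0" and D: "(\<phi> has_real_derivative D) (at x)"
      using deriv[OF \<open>x \<in> {a<..<b} - S\<close>] by blast
    have "(\<psi> has_real_derivative D - \<epsilon>) (at x)"
      unfolding \<psi>_def by (auto intro!: derivative_eq_intros D)
    with \<open>D \<le> 0\<close> \<open>\<epsilon> > 0\<close> show ?thesis by (intro exI[of _ "D - \<epsilon>"]) auto
  qed
  \<comment> \<open>\<open>s y\<close> is the last point at which \<open>\<psi>\<close> does not exceed \<open>y\<close>.\<close>
  define T where "T y = {x \<in> {a..b}. \<psi> x \<le> y}" for y
  define s where "s y = Sup (T y)" for y
  have s: "s y \<in> S \<and> \<psi> (s y) = y" if y: "y \<in> {\<psi> a<..<\<psi> b}" for y
  proof -
    have "T y = {a..b} \<inter> \<psi> -` {..y}" by (auto simp: T_def)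
    then have "closed (T y)"
      using continuous_closed_preimage[OF contp, of "{..y}"] by simp
    moreover have "T y \<noteq> {}" using y \<open>a \<le> b\<close> by (auto simp: T_def)
    moreover have bdd: "bdd_above (T y)" by (auto simp: T_def bdd_above_def)
    ultimately have "s y \<in> T y"
      unfolding s_def by (intro closed_contains_Sup)
    then have sab: "a \<le> s y" "s y \<le> b" and le: "\<psi> (s y) \<le> y" by (auto simp: T_def)
    have ub: "x \<le> s y" if "x \<in> T y" for x
      unfolding s_def by (rule cSup_upper[OF that bdd])
    have "\<exists>x\<ge>s y. x \<le> b \<and> \<psi> x = y"
      using le y sab by (intro IVT') (auto intro: continuous_on_subset[OF contp])
    then obtain x where x: "s y \<le> x" "x \<le> b" "\<psi> x = y" by blast
    then have "x \<in> T y" using sab by (auto simp: T_def)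
    with ub x have eq: "\<psi> (s y) = y" by force
    have "s y \<in> {a<..<b}"
      using sab eq y by (auto simp: less_le)
    moreover have "s y \<in> S"
    proof (rule ccontr)
      assume "s y \<notin> S"
      with \<open>s y \<in> {a<..<b}\<close> obtain D where "D < 0" "(\<psi> has_real_derivative D) (at (s y))"
        using dp by blast
      then obtain d where d: "d > 0" "\<And>h. 0 < h \<Longrightarrow> h < d \<Longrightarrow> \<psi> (s y + h) < \<psi> (s y)"
        using DERIV_neg_dec_right by blast
      define h where "h = min (d / 2) (b - s y)"
      have h: "0 < h" "h < d" "s y + h \<le> b"
        using d(1) \<open>s y \<in> {a<..<b}\<close> by (auto simp: h_def min_def)
      then have "s y + h \<in> T y"
        using d(2)[of h] eq sab by (auto simp: T_def)
      with ub h show False by fastforce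
    qed
    ultimately show ?thesis using eq by blast
  qed
  have "inj_on s {\<psi> a<..<\<psi> b}"
    by (rule inj_on_inverseI[where g = \<psi>]) (use s in blast)
  moreover have "countable (s ` {\<psi> a<..<\<psi> b})"
    using s by (intro countable_subset[OF _ \<open>countable S\<close>]) auto
  ultimately have "countable {\<psi> a<..<\<psi> b}"
    by (rule countable_image_inj_on[rotated])
  with lessp show False using uncountable_open_interval by blast
qed

section \<open>Subgradients of convex functions\<close>

lemma convex_on_subgradient:
  fixes \<phi> :: "real \<Rightarrow> real"
  assumes "convex_on A \<phi>" and "open A"
  obtains p where "mono_on A p"
    and "\<And>x y. x \<in> A \<Longrightarrow> y \<in> A \<Longrightarrow> \<phi> x + p x * (y - x) \<le> \<phi> y"
proof -
  define p where "p x = Inf ((\<lambda>t. (\<phi> x - \<phi> t) / (x - t)) ` ({x<..} \<inter> A))" for x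
  have sub: "\<phi> x + p x * (y - x) \<le> \<phi> y" if "x \<in> A" "y \<in> A" for x y
    using convex_le_Inf_differential[OF assms(1), of x y] that \<open>open A\<close>
    by (simp add: p_def interior_open)
  have "p x \<le> p y" if "x \<in> A" "y \<in> A" "x \<le> y" for x y
  proof (cases "x = y")
    case False
    have "p x * (y - x) \<le> p y * (y - x)"
      using sub[OF that(1,2)] sub[OF that(2,1)] by (simp add: algebra_simps)
    with False that(3) show ?thesis by simp
  qed simp
  then have "mono_on A p" by (rule mono_onI)
  with sub that show thesis by blast
qed

text \<open>The difference quotient \<open>(\<phi> y - \<phi> x) / (y - x)\<close> lies between \<open>p x\<close> and \<open>p y\<close>.\<close>

lemma has_real_derivative_subgradient:
  fixes \<phi> p :: "real \<Rightarrow> real"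
  assumes "open A" and "x \<in> A"
    and sub: "\<And>x y. x \<in> A \<Longrightarrow> y \<in> A \<Longrightarrow> \<phi> x + p x * (y - x) \<le> \<phi> y"
    and "isCont p x"
  shows "(\<phi> has_real_derivative p x) (at x)"
  unfolding has_field_derivative_iff
proof (rule tendsto_sandwich)
  have p: "(p \<longlongrightarrow> p x) (at x)" using assms(4) by (simp add: isCont_def)
  show "((\<lambda>y. min (p x) (p y)) \<longlongrightarrow> p x) (at x)"
    using tendsto_min[OF tendsto_const p, of "p x"] by simp
  show "((\<lambda>y. max (p x) (p y)) \<longlongrightarrow> p x) (at x)"
    using tendsto_max[OF tendsto_const p, of "p x"] by simp
  have ev: "\<forall>\<^sub>F y in at x. y \<in> A \<and> y \<noteq> x"
    using assms(1,2) by (metis eventually_at_in_open' eventually_conj eventually_neq_at_within)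
  have *: "min (p x) (p y) \<le> (\<phi> y - \<phi> x) / (y - x) \<and> (\<phi> y - \<phi> x) / (y - x) \<le> max (p x) (p y)"
    if "y \<in> A \<and> y \<noteq> x" for y
  proof -
    have "p x * (y - x) \<le> \<phi> y - \<phi> x" "\<phi> y - \<phi> x \<le> p y * (y - x)"
      using sub[of x y] sub[of y x] \<open>x \<in> A\<close> that by (auto simp: algebra_simps)
    then have "p x \<le> (\<phi> y - \<phi> x) / (y - x) \<and> (\<phi> y - \<phi> x) / (y - x) \<le> p y
      \<or> p y \<le> (\<phi> y - \<phi> x) / (y - x) \<and> (\<phi> y - \<phi> x) / (y - x) \<le> p x"
      using that by (cases "x < y") (auto simp: field_simps)
    then show ?thesis by linarith
  qed
  show "\<forall>\<^sub>F y in at x. min (p x) (p y) \<le> (\<phi> y - \<phi> x) / (y - x)"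
    using ev by eventually_elim (use * in blast)
  show "\<forall>\<^sub>F y in at x. (\<phi> y - \<phi> x) / (y - x) \<le> max (p x) (p y)"
    using ev by eventually_elim (use * in blast)
qed

section \<open>The tail function and the integrated tail\<close>

lemma has_real_derivative_integral_greaterThan:
  fixes f :: "real \<Rightarrow> real"
  assumes int: "set_integrable lborel {a<..} f" and "a < x" and "isCont f x"
  shows "((\<lambda>y. LBINT u:{y<..}. f u) has_real_derivative - f x) (at x)"
proof -
  let ?F = "\<lambda>y. LBINT u:{y<..}. f u"
  have eq: "?F y = ?F a - integral {a..y} f" if "a \<le> y" for y
  proof -
    have i: "set_integrable lborel {a<..y} f" "set_integrable lborel {y<..} f"
      using that by (auto intro: set_integrable_subset[OF int])
    have "{a<..} = {a<..y} \<union> {y<..}" using that by auto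
    moreover have "(LBINT u:{a<..y} \<union> {y<..}. f u) = (LBINT u:{a<..y}. f u) + ?F y"
      using i by (intro set_integral_Un) auto
    ultimately have "?F a = (LBINT u:{a<..y}. f u) + ?F y" by simp
    also have "(LBINT u:{a<..y}. f u) = integral {a<..y} f"
      using i by (simp add: set_borel_integral_eq_integral)
    also have "\<dots> = integral {a..y} f"
    proof (rule integral_subset_negligible)
      have "{a..y} - {a<..y} = {a}" using that by auto
      then show "negligible ({a..y} - {a<..y})" by simp
    qed auto
    finally show ?thesis by simp
  qed
  have "set_integrable lborel {a<..x + 1} f"
    by (auto intro: set_integrable_subset[OF int])
  then have "f integrable_on {a<..x + 1}" by (rule set_borel_integral_eq_integral)
  moreover have "insert a {a<..x + 1} = {a..x + 1}" using \<open>a < x\<close> by auto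
  ultimately have "f integrable_on {a..x + 1}"
    using integrable_on_insert_iff[of f a "{a<..x + 1}"] by simp
  then have "((\<lambda>y. integral {a..y} f) has_real_derivative f x) (at x within {a..x + 1})"
    using \<open>a < x\<close> \<open>isCont f x\<close>
      integral_has_vector_derivative_continuous_at[of f a "x + 1" x "{}"]
    by (simp add: has_real_derivative_iff_has_vector_derivative continuous_at_imp_continuous_at_within)
  then have "((\<lambda>y. integral {a..y} f) has_real_derivative f x) (at x)"
    using \<open>a < x\<close> by (simp add: at_within_Icc_at)
  then have "((\<lambda>y. ?F a - integral {a..y} f) has_real_derivative 0 - f x) (at x)"
    by (intro derivative_intros)
  moreover have "\<forall>\<^sub>F y in nhds x. ?F a - integral {a..y} f = ?F y"
  proof (rule eventually_mono)
    show "\<forall>\<^sub>F y in nhds x. y \<in> {a<..}"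
      using \<open>a < x\<close> by (intro eventually_nhds_in_open) auto
    show "?F a - integral {a..y} f = ?F y" if "y \<in> {a<..}" for y
      by (rule eq[symmetric]) (use that in simp)
  qed
  ultimately show ?thesis
    by (subst (asm) DERIV_cong_ev[OF refl _ refl]) auto
qed

lemma emeasure_Icc_eq_Ioc:
  fixes N :: "real measure"
  assumes "sets N = sets borel" and "emeasure N {a} = 0" and "a \<le> b"
  shows "emeasure N {a..b} = emeasure N {a<..b}"
proof -
  have "{a..b} = {a<..b} \<union> {a}" using \<open>a \<le> b\<close> by auto
  then show ?thesis
    using assms by (simp only:) (intro emeasure_Un_null_set, auto simp: null_sets_def)
qed

text \<open>The standing hypotheses on the random variable. The abbreviations \<open>G\<close>, \<open>U\<close> and \<open>J\<close> are the
  tail function, the demand interval and the integrated tail.\<close>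

locale residual_demand = prob_space M for M :: "'a measure" +
  fixes X :: "'a \<Rightarrow> real"
  assumes X_measurable [measurable]: "X \<in> borel_measurable M"
    and X_nonneg: "AE \<omega> in M. 0 \<le> X \<omega>"
    and X_abs_cont: "absolutely_continuous lborel (distr M borel X)"
    and X_integrable: "integrable M X"
begin

abbreviation "G \<equiv> tail_fun M X"
abbreviation "U \<equiv> demand_interval M X"
abbreviation "J x \<equiv> LBINT u:{x<..}. G u"

lemma tail_eq_prob: "G x = prob {\<omega> \<in> space M. x < X \<omega>}"
  by (rule tail_fun_eq_prob) (fact prob_space_axioms X_measurable)+

lemma tail_bounds: "0 \<le> G x" "G x \<le> 1"
  by (simp_all add: tail_eq_prob)

lemma tail_antimono: "x \<le> y \<Longrightarrow> G y \<le> G x"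
  by (auto simp: tail_eq_prob intro!: finite_measure_mono)

lemma emeasure_distr_greaterThan: "emeasure (distr M borel X) {x<..} = ennreal (G x)"
  by (simp add: emeasure_distr tail_eq_prob emeasure_eq_measure vimage_def Int_def conj_commute)

lemma emeasure_distr_singleton: "emeasure (distr M borel X) {x} = 0"
  using X_abs_cont
  by (auto simp: absolutely_continuous_def null_sets_def subset_iff dest!: spec[of _ "{x}"])

lemma isCont_tail: "isCont G x"
proof -
  interpret D: real_distribution "distr M borel X" by (rule real_distribution_distr) simp
  have "isCont (cdf (distr M borel X)) x"
    using emeasure_distr_singleton[of x] by (simp add: D.isCont_cdf measure_def)
  moreover have "G = (\<lambda>x. 1 - cdf (distr M borel X) x)"
    by (simp add: fun_eq_iff tail_fun_def dist_fun_def)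
  ultimately show ?thesis by simp
qed

lemma continuous_on_tail: "continuous_on A G"
  using isCont_tail by (simp add: continuous_at_imp_continuous_on)

lemma tail_measurable [measurable]: "G \<in> borel_measurable borel"
  using continuous_on_tail by (rule borel_measurable_continuous_onI)

text \<open>The law is concentrated on the nonnegative reals and has no atom at the origin.\<close>

lemma tail_zero: "G 0 = 1"
proof -
  have "AE x in distr M borel X. x \<noteq> 0"
    by (rule AE_I[of _ _ "{0}"]) (auto simp: emeasure_distr_singleton)
  then have "AE \<omega> in M. X \<omega> \<noteq> 0" by (subst (asm) AE_distr_iff) auto
  with X_nonneg have "AE \<omega> in M. 0 < X \<omega>" by eventually_elim auto
  then show ?thesis by (simp add: tail_eq_prob prob_Collect_eq_1)
qed

text \<open>By continuity the tail already vanishes at the right end point, so positivity of the tail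
  characterizes the points strictly below it.\<close>

lemma less_right_end_iff:
  assumes "0 \<le> x"
  shows "ereal x < right_end M X \<longleftrightarrow> 0 < G x"
proof
  assume "ereal x < right_end M X"
  then show "0 < G x"
    by (rule tail_fun_pos[OF prob_space_axioms X_measurable X_nonneg])
next
  assume "0 < G x"
  then have "\<forall>\<^sub>F y in at_right x. 0 < G y"
    using isCont_tail[of x]
    by (intro order_tendstoD(1)[of G "G x"]) (auto simp: isCont_def intro: tendsto_within_subset)
  moreover have "\<forall>\<^sub>F y in at_right x. x < y" by (simp add: eventually_at_right_less)
  ultimately have "\<exists>y. 0 < G y \<and> x < y"
    by (metis (mono_tags, lifting) eventually_conj eventually_happens trivial_limit_at_right_real)
  then obtain y where y: "0 < G y" "x < y" by blast
  have "ereal y \<le> right_end M X"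
    unfolding right_end_def
  proof (rule Inf_greatest, safe)
    fix z assume "dist_fun M X z = 1"
    then have "G z = 0" by (simp add: tail_fun_def)
    then show "ereal y \<le> ereal z" using tail_antimono[of z y] y by (cases "z < y") auto
  qed
  with y show "ereal x < right_end M X" by (metis less_ereal.simps(1) less_le_trans)
qed

lemma mem_interval_iff: "x \<in> U \<longleftrightarrow> 0 < x \<and> 0 < G x"
  using less_right_end_iff[of x] by (auto simp: demand_interval_def)

lemma interval_eq_einterval: "U = einterval 0 (right_end M X)"
  by (auto simp: demand_interval_def einterval_def)

lemma open_interval: "open U"
  by (simp add: interval_eq_einterval)

lemma interval_downward: "y \<in> U \<Longrightarrow> 0 < x \<Longrightarrow> x \<le> y \<Longrightarrow> x \<in> U"
  using tail_antimono[of x y] by (auto simp: mem_interval_iff)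

lemma AE_distr_mem_interval: "AE x in distr M borel X. x \<in> U"
proof -
  have 1: "AE x in distr M borel X. 0 < x"
  proof (subst AE_distr_iff)
    show "AE \<omega> in M. 0 < X \<omega>"
      using tail_zero by (simp add: tail_eq_prob prob_Collect_eq_1)
  qed auto
  have 2: "AE x in distr M borel X. 0 < G x"
  proof (cases "{x. G x = 0} = {}")
    case True
    then show ?thesis using tail_bounds(1) by (auto simp: less_le)
  next
    case False
    define z where "z = Inf {x. G x = 0}"
    have low: "0 \<le> x" if "G x = 0" for x
      using tail_antimono[of x 0] that tail_zero by (cases "0 \<le> x") auto
    have "z \<in> {x. G x = 0}"
      unfolding z_def using False low
      by (intro closed_contains_Inf)
         (auto intro!: bdd_belowI[of _ 0] closed_Collect_eq continuous_on_tail)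
    then have z: "G z = 0" by simp
    have "{x. G x = 0} \<subseteq> {z..}"
      unfolding z_def using low by (auto intro!: cInf_lower bdd_belowI[of _ 0])
    moreover have "{z..} = {z} \<union> {z<..}" by auto
    moreover have "emeasure (distr M borel X) ({z} \<union> {z<..}) = 0"
      by (subst emeasure_Un_null_set)
         (auto simp: null_sets_def emeasure_distr_singleton emeasure_distr_greaterThan z)
    ultimately show ?thesis
      using tail_bounds(1) by (intro AE_I[of _ _ "{z..}"]) (auto simp: less_le)
  qed
  from 1 2 show ?thesis by eventually_elim (simp add: mem_interval_iff)
qed

lemma mrd_eq: "x \<in> U \<Longrightarrow> mrd M X x = J x / G x"
  by (rule mrd_eq_tail_integral[OF prob_space_axioms X_measurable X_nonneg])
     (simp add: demand_interval_def)

lemma mrd_pos: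
  assumes "x \<in> U"
  shows "0 < mrd M X x"
proof -
  let ?A = "{\<omega> \<in> space M. x < X \<omega>}"
  let ?N = "uniform_measure M ?A"
  have pos: "0 < prob ?A" using assms by (simp add: mem_interval_iff tail_eq_prob)
  have um: "?N = density M (\<lambda>\<omega>. ennreal (indicator ?A \<omega> / prob ?A))"
    unfolding uniform_measure_def using pos
    by (intro arg_cong[where f = "density M"] ext)
       (simp add: emeasure_eq_measure ennreal_indicator divide_ennreal[symmetric])
  interpret N: prob_space ?N
    using pos by (intro prob_space_uniform_measure) (auto simp: emeasure_eq_measure)
  have int: "integrable ?N (\<lambda>\<omega>. X \<omega> - x)"
  proof -
    have "integrable M (\<lambda>\<omega>. indicator ?A \<omega> *\<^sub>R (X \<omega> - x))"
      by (intro integrable_mult_indicator Bochner_Integration.integrable_diff X_integrable) auto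
    from integrable_divide[OF this, of "prob ?A"] show ?thesis
      unfolding um by (subst integrable_density) (auto simp: mult.commute)
  qed
  have "AE \<omega> in ?N. 0 < X \<omega> - x"
    by (subst AE_uniform_measure) (use pos in \<open>auto simp: emeasure_eq_measure\<close>)
  then have "0 < (\<integral>\<omega>. X \<omega> - x \<partial>?N)"
    using int by (intro N.expectation_greater)
  then show ?thesis using assms by (simp add: mrd_def demand_interval_def)
qed

lemma tail_integral_pos: "x \<in> U \<Longrightarrow> 0 < J x"
  using mrd_pos[of x] by (simp add: mrd_eq mem_interval_iff zero_less_divide_iff)

text \<open>Integrability comes for free: the integral of a non-integrable function is 0, whereas \<open>J x\<close>, being
  the product of the tail and a positive conditional expectation, is not.\<close>

lemma tail_integrable:
  assumes "x \<in> U"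
  shows "set_integrable lborel {x<..} G"
  using tail_integral_pos[OF assms] not_integrable_integral_eq
  by (fastforce simp: set_integrable_def set_lebesgue_integral_def)

lemma tail_integral_deriv:
  assumes "x \<in> U"
  shows "(J has_real_derivative - G x) (at x)"
proof -
  have "0 < x" using assms by (simp add: mem_interval_iff)
  then have "x / 2 \<in> U" "x / 2 < x" using interval_downward[OF assms] by auto
  then show ?thesis
    by (intro has_real_derivative_integral_greaterThan[OF tail_integrable _ isCont_tail])
qed

section \<open>From IGFR to DGMRD\<close>

lemma tail_deriv_density:
  assumes "is_density M X f" and "isCont f x"
  shows "(G has_real_derivative - f x) (at x)"
proof -
  have pos: "\<And>x. 0 \<le> f x" and eq: "distr M borel X = density lborel (\<lambda>x. ennreal (f x))"
    and "(\<lambda>x. ennreal (f x)) \<in> borel_measurable lborel"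
    using assms(1) by (auto simp: is_density_def distributed_def cong: distr_cong)
  then have "(\<lambda>x. enn2real (ennreal (f x))) \<in> borel_measurable borel" by simp
  then have [measurable]: "f \<in> borel_measurable borel" using pos by simp
  have one: "(\<integral>\<^sup>+x. ennreal (f x) \<partial>lborel) = 1"
  proof -
    have "emeasure (distr M borel X) UNIV = 1"
      using emeasure_space_1 by (simp add: emeasure_distr)
    then show ?thesis by (simp add: eq emeasure_density)
  qed
  then have int: "integrable lborel f"
    using pos by (intro integrableI_nonneg) auto
  have G_eq: "G y = (LBINT u:{y<..}. f u)" for y
  proof -
    have "ennreal (G y) = (\<integral>\<^sup>+u. ennreal (indicator {y<..} u * f u) \<partial>lborel)"
      unfolding emeasure_distr_greaterThan[symmetric] eq
      by (subst emeasure_density) (auto intro!: nn_integral_cong split: split_indicator)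
    also have "\<dots> = ennreal (LBINT u:{y<..}. f u)"
      unfolding set_lebesgue_integral_def real_scaleR_def
      using pos int by (intro nn_integral_eq_integral integrable_real_mult_indicator AE_I2)
        (auto simp: mult.commute intro: integrable_real_mult_indicator)
    finally show ?thesis
      using tail_bounds pos by (subst (asm) ennreal_inj) (auto simp: set_lebesgue_integral_def)
  qed
  have "((\<lambda>y. LBINT u:{y<..}. f u) has_real_derivative - f x) (at x)"
    using int assms(2)
    by (intro has_real_derivative_integral_greaterThan[of "x - 1"])
       (simp_all add: set_integrable_def integrable_real_mult_indicator mult.commute[of "indicator _ _"])
  moreover have "G = (\<lambda>y. LBINT u:{y<..}. f u)" using G_eq by (rule ext)
  ultimately show ?thesis by simp
qed

lemma tail_ratio_antimono:
  assumes f: "is_density M X f" and mono: "mono_on U (gfr M X f)"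
    and a: "a \<in> U" and b: "b \<in> U" and "a \<le> b" and t: "1 \<le> t"
  shows "G (t * b) * G a \<le> G (t * a) * G b"
proof (cases "G (t * b) = 0")
  case True
  then show ?thesis using tail_bounds by simp
next
  case False
  have ab: "0 < a" "0 < b" using a b by (auto simp: mem_interval_iff)
  have "t * b \<in> U" using False tail_bounds(1)[of "t * b"] ab t by (simp add: mem_interval_iff)
  define D where "D = {x \<in> U. \<not> isCont (gfr M X f) x}"
  have D: "countable D"
    unfolding D_def by (rule mono_on_ctble_discont_open[OF open_interval mono])
  have f_eq: "f x = gfr M X f x * G x / x" if "x \<in> U" for x
    using that by (simp add: gfr_def hazard_rate_def mem_interval_iff)
  have deriv: "(G has_real_derivative - f x) (at x)" if "x \<in> U - D" for x
  proof (rule tail_deriv_density[OF f])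
    have "0 < x" "isCont (gfr M X f) x" using that by (auto simp: D_def mem_interval_iff)
    then have "isCont (\<lambda>x. gfr M X f x * G x / x) x"
      by (intro continuous_intros isCont_tail) auto
    moreover have "\<forall>\<^sub>F y in nhds x. f y = gfr M X f y * G y / y"
      using eventually_nhds_in_open[OF open_interval, of x] that f_eq
      by (auto elim!: eventually_mono)
    ultimately show "isCont f x" by (simp add: isCont_cong)
  qed
  \<comment> \<open>Both \<open>x\<close> and \<open>t * x\<close> have to avoid \<open>D\<close>.\<close>
  let ?S = "D \<union> (\<lambda>d. d / t) ` D"
  have "G (t * b) / G b \<le> G (t * a) / G a"
  proof (rule nonincreasing_if_deriv_nonpos_off_countable[OF \<open>a \<le> b\<close>, of "\<lambda>x. G (t * x) / G x" ?S])
    have "G x \<noteq> 0" if "x \<in> {a..b}" for x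
      using interval_downward[OF b, of x] that ab by (auto simp: mem_interval_iff)
    then show "continuous_on {a..b} (\<lambda>x. G (t * x) / G x)"
      by (intro continuous_intros continuous_on_tail
            continuous_on_compose2[OF continuous_on_tail[of UNIV]]) auto
    show "countable ?S" using D by simp
  next
    fix x assume x: "x \<in> {a<..<b} - ?S"
    have xpos: "0 < x" using x ab by auto
    have "x \<le> t * x" using t xpos by simp
    have "x \<in> U" using interval_downward[OF b, of x] x xpos by auto
    have "t * x \<in> U"
      using interval_downward[OF \<open>t * b \<in> U\<close>, of "t * x"] x xpos t by auto
    have "t * x \<notin> D"
    proof
      assume "t * x \<in> D"
      then have "(t * x) / t \<in> ?S" by blast
      with x t show False by auto
    qed
    have G: "0 < G x" "0 < G (t * x)"
      using \<open>x \<in> U\<close> \<open>t * x \<in> U\<close> by (auto simp: mem_interval_iff)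
    have 1: "(G has_real_derivative - f x) (at x)"
      using deriv \<open>x \<in> U\<close> x by auto
    have 2: "((\<lambda>x. G (t * x)) has_real_derivative - f (t * x) * t) (at x)"
      using deriv[of "t * x"] \<open>t * x \<in> U\<close> \<open>t * x \<notin> D\<close>
      by (intro DERIV_chain2[of G]) (auto intro!: derivative_eq_intros)
    have 3: "((\<lambda>x. G (t * x) / G x) has_real_derivative
        ((- f (t * x) * t) * G x - G (t * x) * (- f x)) / (G x * G x)) (at x)"
      using G by (intro DERIV_divide 1 2) auto
    have "((- f (t * x) * t) * G x - G (t * x) * (- f x)) / (G x * G x)
        = G (t * x) / (x * G x) * (gfr M X f x - gfr M X f (t * x))"
      unfolding f_eq[OF \<open>x \<in> U\<close>] f_eq[OF \<open>t * x \<in> U\<close>]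
      using G xpos t by (simp add: field_simps)
    also have "\<dots> \<le> 0"
      using G xpos mono_onD[OF mono \<open>x \<in> U\<close> \<open>t * x \<in> U\<close> \<open>x \<le> t * x\<close>]
      by (intro mult_nonneg_nonpos) auto
    finally show "\<exists>D\<le>0. ((\<lambda>x. G (t * x) / G x) has_real_derivative D) (at x)"
      using 3 by blast
  qed
  then show ?thesis using a b by (simp add: field_simps mem_interval_iff)
qed

lemma tail_integral_scaled:
  assumes "x \<in> U"
  shows "set_integrable lborel {1<..} (\<lambda>t. G (t * x))"
    and "J x = x * (LBINT t:{1<..}. G (t * x))"
proof -
  have x: "0 < x" using assms by (simp add: mem_interval_iff)
  have eq: "indicator {x<..} (0 + x * t) *\<^sub>R G (0 + x * t) = indicator {1<..} t *\<^sub>R G (t * x)" for t :: real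
    using x by (auto simp: indicator_def mult.commute)
  show "set_integrable lborel {1<..} (\<lambda>t. G (t * x))"
    using lborel_integrable_real_affine[OF tail_integrable[OF assms, unfolded set_integrable_def], of x 0] x
    unfolding eq set_integrable_def by simp
  show "J x = x * (LBINT t:{1<..}. G (t * x))"
    using lborel_integral_real_affine[of x "\<lambda>u. indicator {x<..} u *\<^sub>R G u" 0] x
    by (simp only: set_lebesgue_integral_def eq) simp
qed

lemma IGFR_imp_DGMRD:
  assumes "IGFR M X"
  shows "DGMRD M X"
  unfolding DGMRD_def
proof (rule monotone_onI)
  fix a b assume a: "a \<in> U" and b: "b \<in> U" and "a \<le> b"
  obtain f where f: "is_density M X f" "mono_on U (gfr M X f)"
    using assms by (auto simp: IGFR_def)
  have pos: "0 < a" "0 < b" "0 < G a" "0 < G b" using a b by (auto simp: mem_interval_iff)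
  let ?K = "\<lambda>x. LBINT t:{1<..}. G (t * x)"
  have "G a * ?K b = (LBINT t:{1<..}. G a * G (t * b))"
    by simp
  also have "\<dots> \<le> (LBINT t:{1<..}. G b * G (t * a))"
    using tail_ratio_antimono[OF f a b \<open>a \<le> b\<close>] a b
    by (intro set_integral_mono set_integrable_mult_right tail_integral_scaled(1))
       (auto simp: mult.commute)
  also have "\<dots> = G b * ?K a" by simp
  finally have "?K b / G b \<le> ?K a / G a"
    using pos by (simp add: field_simps)
  then show "gmrd M X b \<le> gmrd M X a"
    using a b pos by (simp add: gmrd_def mrd_eq tail_integral_scaled(2))
qed

section \<open>Recognizing a density from the derivative of the tail\<close>

lemma emeasure_distr_Ioc:
  assumes "a \<le> b"
  shows "emeasure (distr M borel X) {a<..b} = ennreal (G a - G b)"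
proof -
  have "{a<..} - {b<..} = {a<..b}" by auto
  then have "emeasure (distr M borel X) {a<..b} = ennreal (G a) - ennreal (G b)"
    using assms emeasure_Diff[of "distr M borel X" "{b<..}" "{a<..}"]
    by (simp add: emeasure_distr_greaterThan)
  then show ?thesis by (simp add: ennreal_minus tail_bounds)
qed

text \<open>The function \<open>x \<mapsto> integral {a..x} f + G x\<close> has derivative 0 off a countable set, and so it is
  constant. The law of \<open>X\<close> and the measure with density \<open>f\<close> thus agree on compact subintervals of \<open>U\<close>.
  An exhaustion of \<open>U\<close> by such intervals extends this to all rays, since neither measure charges
  the complement of \<open>U\<close>.\<close>

lemma is_density_if_tail_deriv:
  assumes [measurable]: "f \<in> borel_measurable borel"
    and nonneg: "\<And>x. 0 \<le> f x" and zero: "\<And>x. x \<notin> U \<Longrightarrow> f x = 0"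
    and "countable S"
    and int: "\<And>a b. a \<in> U \<Longrightarrow> b \<in> U \<Longrightarrow> set_integrable lborel {a..b} f"
    and cont: "\<And>x. x \<in> U - S \<Longrightarrow> isCont f x"
    and deriv: "\<And>x. x \<in> U - S \<Longrightarrow> (G has_real_derivative - f x) (at x)"
  shows "is_density M X f"
proof -
  let ?\<mu> = "density lborel (\<lambda>x. ennreal (f x))"
  let ?\<nu> = "distr M borel X"
  have integral_eq: "integral {a..b} f = G a - G b" if "a \<in> U" "b \<in> U" "a \<le> b" for a b
  proof -
    have f_int: "f integrable_on {a..b}"
      using int[OF that(1,2)] by (rule set_borel_integral_eq_integral)
    define \<Phi> where "\<Phi> x = integral {a..x} f + G x" for x
    have cont\<Phi>: "continuous_on {a..b} \<Phi>"
      unfolding \<Phi>_def by (intro continuous_intros indefinite_integral_continuous_1 f_int continuous_on_tail)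
    have d\<Phi>: "(\<Phi> has_real_derivative 0) (at x)" if x: "x \<in> {a<..<b} - S" for x
    proof -
      have "0 < x" using x \<open>a \<in> U\<close> by (auto simp: mem_interval_iff)
      then have xU: "x \<in> U - S" using interval_downward[OF \<open>b \<in> U\<close>, of x] x by auto
      have "((\<lambda>x. integral {a..x} f) has_real_derivative f x) (at x within {a..b})"
        using f_int cont[OF xU] x integral_has_vector_derivative_continuous_at[of f a b x "{}"]
        by (simp add: has_real_derivative_iff_has_vector_derivative continuous_at_imp_continuous_at_within)
      then have "((\<lambda>x. integral {a..x} f) has_real_derivative f x) (at x)"
        using x by (simp add: at_within_Icc_at)
      from DERIV_add[OF this deriv[OF xU]] show ?thesis by (simp add: \<Phi>_def[abs_def])
    qed
    have "\<Phi> b \<le> \<Phi> a"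
      using d\<Phi> by (intro nonincreasing_if_deriv_nonpos_off_countable[OF \<open>a \<le> b\<close> cont\<Phi> \<open>countable S\<close>]) auto
    moreover have "- \<Phi> b \<le> - \<Phi> a"
      using DERIV_minus[OF d\<Phi>] cont\<Phi>
      by (intro nonincreasing_if_deriv_nonpos_off_countable[OF \<open>a \<le> b\<close> _ \<open>countable S\<close>])
         (auto intro!: continuous_intros)
    ultimately show ?thesis by (simp add: \<Phi>_def)
  qed
  have \<mu>_singleton: "emeasure ?\<mu> {x} = 0" for x
  proof -
    have "AE y in lborel. y \<noteq> x" by (rule AE_lborel_singleton)
    then have "AE y in lborel. ennreal (f y) * indicator {x} y = 0" by eventually_elim auto
    then show ?thesis by (simp add: emeasure_density nn_integral_0_iff_AE)
  qed
  have Icc: "emeasure ?\<mu> {a..b} = emeasure ?\<nu> {a..b}" if "a \<in> U" "b \<in> U" "a \<le> b" for a b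
  proof -
    have "f integrable_on {a..b}"
      using int[OF that(1,2)] by (rule set_borel_integral_eq_integral)
    then have hi: "(f has_integral (G a - G b)) {a..b}"
      using integral_eq[OF that] by (metis integrable_integral)
    have "emeasure ?\<mu> {a..b} = (\<integral>\<^sup>+x. ennreal (indicator {a..b} x * f x) \<partial>lborel)"
      by (subst emeasure_density) (auto intro!: nn_integral_cong split: split_indicator)
    also have "\<dots> = ennreal (G a - G b)"
      using nonneg hi by (rule nn_integral_has_integral_lebesgue)
    also have "\<dots> = emeasure ?\<nu> {a..b}"
      using that by (simp add: emeasure_Icc_eq_Ioc emeasure_distr_singleton emeasure_distr_Ioc)
    finally show ?thesis .
  qed
  obtain u l where ul: "U = (\<Union>i. {l i..u i})" "incseq u" "decseq l" "\<And>i. l i < u i"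
  proof -
    have "(0::ereal) < right_end M X"
      using less_right_end_iff[of 0] tail_zero by (simp add: zero_ereal_def)
    then show thesis
      by (rule einterval_Icc_approximation) (rule that[unfolded interval_eq_einterval])
  qed
  have eq: "emeasure ?\<mu> {x<..} = emeasure ?\<nu> {x<..}" for x
  proof -
    let ?A = "\<lambda>i. {x<..} \<inter> {l i..u i}"
    have inc: "incseq ?A"
    proof (rule incseq_SucI)
      fix i show "?A i \<subseteq> ?A (Suc i)"
        using incseq_SucD[OF ul(2), of i] decseq_SucD[OF ul(3), of i] by auto
    qed
    have A_eq: "emeasure ?\<mu> (?A i) = emeasure ?\<nu> (?A i)" for i
    proof -
      have lu: "l i \<in> U" "u i \<in> U" using ul(1) ul(4)[of i] by (auto intro: less_imp_le)
      consider "x < l i" | "l i \<le> x" "x < u i" | "u i \<le> x" by linarith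
      then show ?thesis
      proof cases
        case 1
        then have "?A i = {l i..u i}" by auto
        then show ?thesis using Icc[OF lu] ul(4)[of i] by simp
      next
        case 2
        then have "?A i = {x<..u i}" by auto
        moreover have "x \<in> U"
          using 2 lu by (intro interval_downward[OF lu(2)]) (auto simp: mem_interval_iff)
        ultimately show ?thesis
          using Icc[OF _ lu(2), of x] 2
          by (simp add: emeasure_Icc_eq_Ioc emeasure_distr_singleton \<mu>_singleton)
      next
        case 3
        then have "?A i = {}" by auto
        then show ?thesis by simp
      qed
    qed
    have U_eq: "(\<Union>i. ?A i) = {x<..} \<inter> U" using ul(1) by auto
    have "emeasure ?\<mu> {x<..} = emeasure ?\<mu> ({x<..} \<inter> U)"
      using zero by (simp add: emeasure_density open_interval borel_open)
        (auto intro!: nn_integral_cong split: split_indicator)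
    also have "\<dots> = (SUP i. emeasure ?\<mu> (?A i))"
      unfolding U_eq[symmetric] by (intro SUP_emeasure_incseq[symmetric] inc) auto
    also have "\<dots> = (SUP i. emeasure ?\<nu> (?A i))" by (simp only: A_eq)
    also have "\<dots> = emeasure ?\<nu> ({x<..} \<inter> U)"
      unfolding U_eq[symmetric] by (intro SUP_emeasure_incseq inc) auto
    also have "\<dots> = emeasure ?\<nu> {x<..}"
      using AE_distr_mem_interval
      by (intro emeasure_eq_AE) (auto simp: open_interval borel_open)
    finally show ?thesis .
  qed
  have "?\<nu> = ?\<mu>"
    by (rule measure_eqI_lessThan) (auto simp: eq emeasure_distr_greaterThan)
  moreover have "distr M lborel X = ?\<nu>" by (intro distr_cong) auto
  ultimately show ?thesis
    using nonneg by (simp add: is_density_def distributed_def)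
qed

section \<open>From DGMRD and log-convexity to IGFR\<close>

lemma DGMRD_log_convex_imp_IGFR:
  assumes dg: "DGMRD M X" and lc: "mrd_log_convex M X"
  shows "IGFR M X"
proof -
  define \<phi> where "\<phi> x = ln (mrd M X x)" for x
  have pos: "0 < x" "0 < G x" "0 < J x" if "x \<in> U" for x
    using that tail_integral_pos by (auto simp: mem_interval_iff)
  have \<phi>_eq: "\<phi> x = ln (J x) - ln (G x)" if "x \<in> U" for x
    using pos[OF that] by (simp add: \<phi>_def mrd_eq[OF that] ln_div)
  obtain p where p_mono: "mono_on U p"
    and sub: "\<And>x y. x \<in> U \<Longrightarrow> y \<in> U \<Longrightarrow> \<phi> x + p x * (y - x) \<le> \<phi> y"
    using convex_on_subgradient[of U \<phi>] lc open_interval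
    unfolding mrd_log_convex_def \<phi>_def by blast
  \<comment> \<open>On \<open>U\<close> the quotient \<open>G x / J x\<close> is \<open>1 / mrd M X x\<close>.\<close>
  define h where "h x = G x / J x + p x" for x
  define f where "f x = indicator U x * (h x * G x)" for x
  have lnJ_deriv: "((\<lambda>y. ln (J y)) has_real_derivative - (G x / J x)) (at x)" if "x \<in> U" for x
    using DERIV_chain2[OF DERIV_ln_divide tail_integral_deriv[OF that]] pos[OF that] by simp
  have h_nonneg: "0 \<le> h x" if x: "x \<in> U" for x
  proof (rule ccontr)
    assume "\<not> 0 \<le> h x"
    \<comment> \<open>To the left of \<open>x\<close>, antitonicity of \<open>G\<close> and the subgradient inequality bound this function below
      by its value at \<open>x\<close>, so its derivative there cannot be positive.\<close>
    have "((\<lambda>y. ln (J y) - p x * y) has_real_derivative - h x) (at x)"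
      using DERIV_diff[OF lnJ_deriv[OF x] DERIV_cmult[OF DERIV_ident, of "p x"]]
      by (simp add: h_def)
    then obtain d where d: "d > 0"
      "\<And>e. 0 < e \<Longrightarrow> e < d \<Longrightarrow> ln (J (x - e)) - p x * (x - e) < ln (J x) - p x * x"
      using DERIV_pos_inc_left[of "\<lambda>y. ln (J y) - p x * y" "- h x" x] \<open>\<not> 0 \<le> h x\<close> by auto
    define y where "y = x - min (d / 2) (x / 2)"
    have y: "0 < y" "y < x" "x - y < d"
      using d(1) pos(1)[OF x] by (auto simp: y_def min_def)
    then have "y \<in> U" using interval_downward[OF x, of y] by simp
    have "ln (J y) - p x * y < ln (J x) - p x * x"
      using d(2)[of "x - y"] y by simp
    moreover have "ln (G x) \<le> ln (G y)"
      using tail_antimono[of y x] y pos x \<open>y \<in> U\<close> by simp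
    moreover have "\<phi> x + p x * (y - x) \<le> \<phi> y"
      using sub x \<open>y \<in> U\<close> by blast
    ultimately show False
      using \<phi>_eq[OF x] \<phi>_eq[OF \<open>y \<in> U\<close>] by (simp add: algebra_simps)
  qed
  have g_mono: "mono_on U (\<lambda>x. x * h x)"
  proof (rule mono_onI)
    fix x y assume x: "x \<in> U" and y: "y \<in> U" and "x \<le> y"
    note px = pos[OF x] and py = pos[OF y]
    have pxy: "p x \<le> p y" using p_mono x y \<open>x \<le> y\<close> by (rule mono_onD)
    show "x * h x \<le> y * h y"
    proof (cases "0 \<le> p y")
      case True
      have "gmrd M X y \<le> gmrd M X x"
        using dg x y \<open>x \<le> y\<close> unfolding DGMRD_def by (rule monotone_onD)
      then have "J y / G y / y \<le> J x / G x / x"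
        by (simp add: gmrd_def mrd_eq x y)
      then have "x * (G x / J x) \<le> y * (G y / J y)"
        using px py by (simp add: field_simps)
      moreover have "x * p x \<le> x * p y" using pxy px by simp
      moreover have "x * p y \<le> y * p y" using \<open>x \<le> y\<close> True by (rule mult_right_mono)
      ultimately show ?thesis by (simp add: h_def distrib_left)
    next
      case False
      have "0 \<le> p y * (x - y)" using False \<open>x \<le> y\<close> by (intro mult_nonpos_nonpos) auto
      then have "\<phi> y \<le> \<phi> x" using sub[OF y x] by simp
      then have "mrd M X y \<le> mrd M X x"
        using mrd_pos x y by (simp add: \<phi>_def)
      then have "G x / J x \<le> G y / J y"
        using px py by (simp add: mrd_eq x y field_simps)
      then have "h x \<le> h y" using pxy by (simp add: h_def)
      then show ?thesis
        using \<open>x \<le> y\<close> px h_nonneg[OF x] py by (intro mult_mono) auto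
    qed
  qed
  have f_eq: "f x = x * h x * G x / x" if "x \<in> U" for x
    using that pos[OF that] by (simp add: f_def)
  have U_sets [measurable]: "U \<in> sets borel" using open_interval by (rule borel_open)
  have f_meas [measurable]: "f \<in> borel_measurable borel"
  proof -
    have "(\<lambda>x. x * h x) \<in> borel_measurable (restrict_space borel U)"
      by (rule borel_measurable_mono_on_fnc[OF g_mono])
    then have "(\<lambda>x. indicator U x *\<^sub>R (x * h x)) \<in> borel_measurable borel"
      by (subst (asm) borel_measurable_restrict_space_iff) auto
    then have "(\<lambda>x. indicator U x *\<^sub>R (x * h x) * G x / x) \<in> borel_measurable borel"
      by measurable
    moreover have "f = (\<lambda>x. indicator U x *\<^sub>R (x * h x) * G x / x)"
      using pos(1) by (auto simp: f_def fun_eq_iff split: split_indicator)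
    ultimately show ?thesis by simp
  qed
  have f_nonneg: "0 \<le> f x" for x
    using h_nonneg tail_bounds by (auto simp: f_def split: split_indicator)
  define S where "S = {x \<in> U. \<not> isCont p x}"
  have "is_density M X f"
  proof (rule is_density_if_tail_deriv)
    show "countable S"
      unfolding S_def by (rule mono_on_ctble_discont_open[OF open_interval p_mono])
    show "f x = 0" if "x \<notin> U" for x using that by (simp add: f_def)
    fix a b assume a: "a \<in> U" and b: "b \<in> U"
    have bound: "norm (f x) \<le> b * h b / a" if "x \<in> {a..b}" for x
    proof -
      have "0 < x" using that pos[OF a] by auto
      then have x: "x \<in> U" using interval_downward[OF b, of x] that by auto
      have "x * h x \<le> b * h b" using mono_onD[OF g_mono x b] that by simp
      moreover have "0 \<le> b * h b" using h_nonneg[OF b] pos(1)[OF b] by simp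
      ultimately have "(x * h x) * G x \<le> (b * h b) * 1"
        using mult_mono[of "x * h x" "b * h b" "G x" 1] tail_bounds[of x] by blast
      then have "x * h x * G x / x \<le> b * h b * 1 / a"
        using that \<open>0 \<le> b * h b\<close> pos(1)[OF a] by (intro frac_le) auto
      then show ?thesis using f_nonneg[of x] f_eq[OF x] by simp
    qed
    show "set_integrable lborel {a..b} f"
      unfolding set_integrable_def
      by (rule integrableI_bounded_set_indicator[where B = "b * h b / a"])
         (use bound in \<open>auto intro!: AE_I2 simp: emeasure_lborel_Icc_eq\<close>)
  next
    fix x assume "x \<in> U - S"
    then have x: "x \<in> U" and "isCont p x" by (auto simp: S_def)
    have near: "\<forall>\<^sub>F y in nhds x. y \<in> U"
      using open_interval x by (rule eventually_nhds_in_open)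
    have "isCont (\<lambda>x. h x * G x) x"
      unfolding h_def using pos[OF x] \<open>isCont p x\<close> DERIV_isCont[OF tail_integral_deriv[OF x]]
      by (intro continuous_intros isCont_tail) auto
    moreover have "\<forall>\<^sub>F y in nhds x. f y = h y * G y"
      using near by eventually_elim (simp add: f_def)
    ultimately show "isCont f x" by (simp add: isCont_cong)
    have "(\<phi> has_real_derivative p x) (at x)"
      by (rule has_real_derivative_subgradient[OF open_interval x sub \<open>isCont p x\<close>])
    then have "((\<lambda>y. J y * exp (- \<phi> y)) has_real_derivative
        - G x * exp (- \<phi> x) + (exp (- \<phi> x) * (- p x)) * J x) (at x)"
      by (intro DERIV_mult tail_integral_deriv[OF x] DERIV_chain2[OF DERIV_exp] DERIV_minus)
    moreover have G_eq: "J y * exp (- \<phi> y) = G y" if "y \<in> U" for y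
      using pos[OF that] by (simp add: \<phi>_eq[OF that] exp_diff)
    then have "\<forall>\<^sub>F y in nhds x. J y * exp (- \<phi> y) = G y"
      using near by (auto elim: eventually_mono)
    ultimately have "(G has_real_derivative
        - G x * exp (- \<phi> x) + (exp (- \<phi> x) * (- p x)) * J x) (at x)"
      by (subst (asm) DERIV_cong_ev[OF refl _ refl]) auto
    moreover have "exp (- \<phi> x) = G x / J x"
      using G_eq[OF x] pos[OF x] by (simp add: field_simps)
    then have "- G x * exp (- \<phi> x) + (exp (- \<phi> x) * (- p x)) * J x = - f x"
      using x pos[OF x] by (simp add: f_def h_def field_simps)
    ultimately show "(G has_real_derivative - f x) (at x)" by simp
  qed (use f_nonneg in auto)
  moreover have "mono_on U (gfr M X f)"
  proof -
    have "gfr M X f x = x * h x" if "x \<in> U" for x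
      using that pos(2)[OF that] by (simp add: gfr_def hazard_rate_def f_def)
    with g_mono show ?thesis by (auto simp: mono_on_def)
  qed
  ultimately show ?thesis unfolding IGFR_def by blast
qed

end

theorem theorem3p1:
  fixes M :: "'a measure" and X :: "'a \<Rightarrow> real"
  assumes "prob_space M"
    and "X \<in> borel_measurable M"
    and "AE \<omega> in M. 0 \<le> X \<omega>"
    and "absolutely_continuous lborel (distr M borel X)"
    and "integrable M X"
  shows "(IGFR M X \<longrightarrow> DGMRD M X) \<and>
         (DGMRD M X \<and> mrd_log_convex M X \<longrightarrow> IGFR M X)"
proof -
  interpret residual_demand M X
    using assms by (simp add: residual_demand_def residual_demand_axioms_def)
  show ?thesis using IGFR_imp_DGMRD DGMRD_log_convex_imp_IGFR by blast
qed

end
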